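(* Let $K$ be an algebraically closed field of characteristic $\ne 2$, $n\ge2$ even, $G=\mathrm{PGL}_n(K)$, and let $D$ be a nontrivial toral elementary abelian $2$-subgroup of $G$ with $C_G(D)=C_G(D)^\circ$. Then $D$ contains an involution not $G$-conjugate to $e_{n/2}$, the image in $G$ of $\mathrm{diag}(-I_{n/2},I_{n/2})$.
   Context: Toral: contained in a maximal torus of $G$. $C_G(D)^\circ$ denotes the identity component of the centralizer. *)

theory Defs
  imports "Jordan_Normal_Form.Determinant" "HOL-Algebra.Group" "HOL-Computational_Algebra.Polynomial"
begin

definition alg_closed_field :: "'a::field itself \<Rightarrow> bool" where
  "alg_closed_field _ \<longleftrightarrow> (\<forall>p :: 'a poly. degree p > 0 \<longrightarrow> (\<exists>x. poly p x = 0))"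

definition GL_set :: "nat \<Rightarrow> 'a::field mat set" where
  "GL_set n = {A \<in> carrier_mat n n. det A \<noteq> 0}"

definition proj_class :: "'a::field mat \<Rightarrow> 'a mat set" where
  "proj_class A = {c \<cdot>\<^sub>m A | c. c \<noteq> 0}"

definition rep_class :: "'a mat set \<Rightarrow> 'a mat" where
  "rep_class P = (SOME A. A \<in> P)"

definition PGL :: "nat \<Rightarrow> ('a::field mat set) monoid" where
  "PGL n = \<lparr> carrier = proj_class ` GL_set n,
             mult = (\<lambda>P Q. proj_class (rep_class P * rep_class Q)),
             one = proj_class (1\<^sub>m n) \<rparr>"

inductive_set poly_fun :: "nat \<Rightarrow> ('a::field mat \<Rightarrow> 'a) set" for n where
  const: "(\<lambda>A. c) \<in> poly_fun n"
| entry: "i < n \<Longrightarrow> j < n \<Longrightarrow> (\<lambda>A. A $$ (i, j)) \<in> poly_fun n"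
| add: "f \<in> poly_fun n \<Longrightarrow> g \<in> poly_fun n \<Longrightarrow> (\<lambda>A. f A + g A) \<in> poly_fun n"
| mult: "f \<in> poly_fun n \<Longrightarrow> g \<in> poly_fun n \<Longrightarrow> (\<lambda>A. f A * g A) \<in> poly_fun n"

text \<open>Zariski-closed subsets of GL_n (the affine variety GL_n; zero sets of f/det^k
  agree with zero sets of f on GL_n).\<close>
definition GL_closed :: "nat \<Rightarrow> 'a::field mat set \<Rightarrow> bool" where
  "GL_closed n S \<longleftrightarrow> (\<exists>F \<subseteq> poly_fun n. S = {A \<in> GL_set n. \<forall>f\<in>F. f A = 0})"

text \<open>Zariski topology of PGL_n = quotient topology of the quotient map GL_n \<rightarrow> PGL_n.\<close>
definition PGL_closed :: "nat \<Rightarrow> 'a::field mat set set \<Rightarrow> bool" where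
  "PGL_closed n C \<longleftrightarrow> C \<subseteq> carrier (PGL n) \<and> GL_closed n (\<Union>C)"

definition PGL_connected :: "nat \<Rightarrow> 'a::field mat set set \<Rightarrow> bool" where
  "PGL_connected n S \<longleftrightarrow> \<not> (\<exists>C1 C2. PGL_closed n C1 \<and> PGL_closed n C2 \<and> S \<subseteq> C1 \<union> C2 \<and>
        C1 \<inter> C2 \<inter> S = {} \<and> C1 \<inter> S \<noteq> {} \<and> C2 \<inter> S \<noteq> {})"

definition PGL_identity_component :: "nat \<Rightarrow> 'a::field mat set set \<Rightarrow> 'a mat set set" where
  "PGL_identity_component n H =
     \<Union>{S. S \<subseteq> H \<and> \<one>\<^bsub>PGL n\<^esub> \<in> S \<and> PGL_connected n S}"

definition PGL_centralizer :: "nat \<Rightarrow> 'a::field mat set set \<Rightarrow> 'a mat set set" where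
  "PGL_centralizer n D = {g \<in> carrier (PGL n). \<forall>d\<in>D. g \<otimes>\<^bsub>PGL n\<^esub> d = d \<otimes>\<^bsub>PGL n\<^esub> g}"

definition PGL_semisimple :: "nat \<Rightarrow> 'a::field mat set \<Rightarrow> bool" where
  "PGL_semisimple n P \<longleftrightarrow> (\<exists>Q \<in> carrier_mat n n. \<exists>R \<in> carrier_mat n n.
      Q * R = 1\<^sub>m n \<and> diagonal_mat (R * rep_class P * Q))"

text \<open>A torus: a closed connected diagonalizable subgroup, i.e. closed, connected,
  commutative and consisting of semisimple elements.\<close>
definition PGL_torus :: "nat \<Rightarrow> 'a::field mat set set \<Rightarrow> bool" where
  "PGL_torus n T \<longleftrightarrow> subgroup T (PGL n) \<and> PGL_closed n T \<and> PGL_connected n T \<and>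
     (\<forall>x\<in>T. \<forall>y\<in>T. x \<otimes>\<^bsub>PGL n\<^esub> y = y \<otimes>\<^bsub>PGL n\<^esub> x) \<and> (\<forall>x\<in>T. PGL_semisimple n x)"

definition PGL_maximal_torus :: "nat \<Rightarrow> 'a::field mat set set \<Rightarrow> bool" where
  "PGL_maximal_torus n T \<longleftrightarrow> PGL_torus n T \<and> (\<forall>T'. PGL_torus n T' \<and> T \<subseteq> T' \<longrightarrow> T' = T)"

definition PGL_toral :: "nat \<Rightarrow> 'a::field mat set set \<Rightarrow> bool" where
  "PGL_toral n D \<longleftrightarrow> (\<exists>T. PGL_maximal_torus n T \<and> D \<subseteq> T)"

definition elem_abelian_2_subgroup :: "('b, 'c) monoid_scheme \<Rightarrow> 'b set \<Rightarrow> bool" where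
  "elem_abelian_2_subgroup G D \<longleftrightarrow> subgroup D G \<and>
     (\<forall>x\<in>D. \<forall>y\<in>D. x \<otimes>\<^bsub>G\<^esub> y = y \<otimes>\<^bsub>G\<^esub> x) \<and> (\<forall>x\<in>D. x \<otimes>\<^bsub>G\<^esub> x = \<one>\<^bsub>G\<^esub>)"

definition conjugate_in :: "('b, 'c) monoid_scheme \<Rightarrow> 'b \<Rightarrow> 'b \<Rightarrow> bool" where
  "conjugate_in G x y \<longleftrightarrow> (\<exists>g\<in>carrier G. g \<otimes>\<^bsub>G\<^esub> x \<otimes>\<^bsub>G\<^esub> inv\<^bsub>G\<^esub> g = y)"

definition e_elem :: "nat \<Rightarrow> nat \<Rightarrow> 'a::field mat set" where
  "e_elem n k = proj_class (mat n n (\<lambda>(i, j). if i = j then (if i < k then -1 else 1) else 0))"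

end

theory Submission
  imports Defs "HOL-Combinatorics.List_Permutation" "Jordan_Normal_Form.Char_Poly"
begin

text \<open>
  Suppose every non-identity element of \<open>D\<close> is conjugate to \<open>e\<^bsub>n/2\<^esub>\<close>; then every element of \<open>D\<close> lifts
  to an involutory matrix. The commutator of lifts with a fixed such lift is a sign, and it is
  constant on connected sets. Applied to a torus containing \<open>D\<close> this shows that the lifts of \<open>D\<close>
  commute, so they are simultaneously diagonal with entries \<open>\<plusminus>1\<close>. Recording the positions of the entries
  \<open>-1\<close> turns them into a binary linear code of length \<open>n\<close> that contains the all-one word and in which
  every other nonzero word has weight \<open>n/2\<close>. By orthogonality of characters, every character of the code that
  is \<open>-1\<close> at the all-one word occurs as a coordinate equally often. Hence multiplication by the
  quotient of two coordinates is induced by a permutation of the coordinates, and the corresponding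
  permutation matrix centralizes \<open>D\<close> while anticommuting with some lift. As the sign is constant
  on connected sets, it is not in the identity component of the centralizer.
\<close>

subsection \<open>Projective classes and commuting lifts\<close>

lemma proj_class_self: "A \<in> proj_class A"
proof -
  have "A = 1 \<cdot>\<^sub>m A" by (intro eq_matI) auto
  then show ?thesis unfolding proj_class_def by (metis (mono_tags, lifting) mem_Collect_eq one_neq_zero)
qed

lemma smult_smult_mat: "a \<cdot>\<^sub>m (b \<cdot>\<^sub>m A) = (a * b) \<cdot>\<^sub>m (A :: 'a::semigroup_mult mat)"
  by (intro eq_matI) (auto simp: mult.assoc)

lemma one_smult_mat [simp]: "1 \<cdot>\<^sub>m A = (A :: 'a::monoid_mult mat)"
  by (intro eq_matI) auto

lemma proj_class_smult: "c \<noteq> 0 \<Longrightarrow> proj_class (c \<cdot>\<^sub>m A) = proj_class (A :: 'a::field mat)"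
proof -
  assume c: "c \<noteq> 0"
  have "\<exists>d. x \<cdot>\<^sub>m A = d \<cdot>\<^sub>m (c \<cdot>\<^sub>m A) \<and> d \<noteq> 0" if "x \<noteq> 0" for x
    using c that by (intro exI[of _ "x / c"]) (simp add: smult_smult_mat)
  then show ?thesis using c unfolding proj_class_def by (force simp: smult_smult_mat)
qed

lemma proj_class_eq_iff: "proj_class A = proj_class B \<longleftrightarrow> (\<exists>c. c \<noteq> 0 \<and> A = c \<cdot>\<^sub>m B)"
proof
  assume "proj_class A = proj_class B"
  then have "A \<in> proj_class B" using proj_class_self by metis
  then show "\<exists>c. c \<noteq> 0 \<and> A = c \<cdot>\<^sub>m B" unfolding proj_class_def by auto
qed (auto simp: proj_class_smult)

lemma rep_class_proj_class: obtains c where "c \<noteq> 0" "rep_class (proj_class A) = c \<cdot>\<^sub>m A"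
proof -
  have "rep_class (proj_class A) \<in> proj_class A"
    unfolding rep_class_def by (rule someI, rule proj_class_self)
  then show ?thesis using that unfolding proj_class_def by auto
qed

lemma GL_set_carrier: "A \<in> GL_set n \<Longrightarrow> A \<in> carrier_mat n n"
  by (simp add: GL_set_def)

lemma GL_set_mult: "A \<in> GL_set n \<Longrightarrow> B \<in> GL_set n \<Longrightarrow> A * B \<in> GL_set n"
  by (auto simp: GL_set_def det_mult)

lemma GL_set_one: "1\<^sub>m n \<in> GL_set n"
  by (auto simp: GL_set_def)

lemma GL_set_smult: "c \<noteq> 0 \<Longrightarrow> A \<in> GL_set n \<Longrightarrow> c \<cdot>\<^sub>m A \<in> GL_set n"
  by (auto simp: GL_set_def)

lemma GL_setI:
  assumes "A \<in> carrier_mat n n" "B \<in> carrier_mat n n" "A * B = 1\<^sub>m n"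
  shows "A \<in> GL_set n"
proof -
  have "det A * det B = 1" using det_mult[OF assms(1,2)] assms(3) by simp
  then show ?thesis using assms(1) by (auto simp: GL_set_def)
qed

lemma GL_set_inverse:
  assumes "A \<in> GL_set n"
  obtains B where "B \<in> GL_set n" "A * B = 1\<^sub>m n" "B * A = 1\<^sub>m n"
proof -
  have "A \<in> carrier_mat n n" "det A \<noteq> 0" using assms by (auto simp: GL_set_def)
  from det_non_zero_imp_unit[OF this, of "()"] obtain B where
    "B \<in> carrier_mat n n" "B * A = 1\<^sub>m n" "A * B = 1\<^sub>m n"
    unfolding Units_def ring_mat_def by auto
  then show ?thesis using that GL_setI \<open>A \<in> carrier_mat n n\<close> by blast
qed

lemma PGL_carrier: "carrier (PGL n) = proj_class ` GL_set n"
  and PGL_one: "\<one>\<^bsub>PGL n\<^esub> = proj_class (1\<^sub>m n)"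
  by (simp_all add: PGL_def)

text \<open>The product of \<open>PGL n\<close> multiplies arbitrarily chosen representatives. They
  differ from the given ones by nonzero scalars, which come out of the matrix product and leave its
  class unchanged.\<close>

lemma PGL_mult:
  assumes "A \<in> carrier_mat n n" "B \<in> carrier_mat n n"
  shows "proj_class A \<otimes>\<^bsub>PGL n\<^esub> proj_class B = proj_class (A * B)"
proof -
  obtain a where a: "a \<noteq> 0" "rep_class (proj_class A) = a \<cdot>\<^sub>m A" by (rule rep_class_proj_class)
  obtain b where b: "b \<noteq> 0" "rep_class (proj_class B) = b \<cdot>\<^sub>m B" by (rule rep_class_proj_class)
  have "(a \<cdot>\<^sub>m A) * (b \<cdot>\<^sub>m B) = (a * b) \<cdot>\<^sub>m (A * B)"
    using assms by (simp add: mult_smult_distrib[of _ n n _ n] mult_smult_assoc_mat[of _ n n _ n]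
        smult_smult_mat mult.commute)
  then show ?thesis using a b by (simp add: PGL_def proj_class_smult)
qed

lemma group_PGL: "group (PGL n :: ('a::field mat set) monoid)"
proof (rule groupI)
  fix x y :: "'a mat set" assume "x \<in> carrier (PGL n)" "y \<in> carrier (PGL n)"
  then show "x \<otimes>\<^bsub>PGL n\<^esub> y \<in> carrier (PGL n)"
    by (auto simp: PGL_carrier PGL_mult GL_set_carrier GL_set_mult)
next
  show "\<one>\<^bsub>PGL n\<^esub> \<in> carrier (PGL n :: ('a mat set) monoid)" by (simp add: PGL_carrier PGL_one GL_set_one)
next
  fix x y z :: "'a mat set" assume "x \<in> carrier (PGL n)" "y \<in> carrier (PGL n)" "z \<in> carrier (PGL n)"
  then obtain A B C where "A \<in> carrier_mat n n" "B \<in> carrier_mat n n" "C \<in> carrier_mat n n"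
    "x = proj_class A" "y = proj_class B" "z = proj_class C"
    unfolding PGL_carrier using GL_set_carrier by blast
  then show "x \<otimes>\<^bsub>PGL n\<^esub> y \<otimes>\<^bsub>PGL n\<^esub> z = x \<otimes>\<^bsub>PGL n\<^esub> (y \<otimes>\<^bsub>PGL n\<^esub> z)"
    by (simp add: PGL_mult[of _ n])
next
  fix x :: "'a mat set" assume "x \<in> carrier (PGL n)"
  then obtain A where A: "A \<in> GL_set n" "x = proj_class A" by (auto simp: PGL_carrier)
  then show "\<one>\<^bsub>PGL n\<^esub> \<otimes>\<^bsub>PGL n\<^esub> x = x"
    using GL_set_carrier[OF A(1)] by (simp add: PGL_one PGL_mult)
  obtain B where "B \<in> GL_set n" "B * A = 1\<^sub>m n" using GL_set_inverse[OF A(1)] by metis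
  then show "\<exists>y\<in>carrier (PGL n). y \<otimes>\<^bsub>PGL n\<^esub> x = \<one>\<^bsub>PGL n\<^esub>"
    using A by (intro bexI[of _ "proj_class B"]) (auto simp: PGL_carrier PGL_one PGL_mult GL_set_carrier)
qed

text \<open>Clearing the inverse turns conjugacy of classes into a matrix equation in which only an
  unknown scalar \<open>c\<close> remains.\<close>

lemma conjugate_in_PGL_imp:
  assumes A: "A \<in> GL_set n" and E: "E \<in> GL_set n"
    and conj: "conjugate_in (PGL n) (proj_class A) (proj_class E)"
  obtains G c where "G \<in> GL_set n" "c \<noteq> 0" "G * A = c \<cdot>\<^sub>m (E * G)"
proof -
  interpret group "PGL n" by (rule group_PGL)
  from conj obtain g where g: "g \<in> carrier (PGL n)"
    and eq: "g \<otimes>\<^bsub>PGL n\<^esub> proj_class A \<otimes>\<^bsub>PGL n\<^esub> inv\<^bsub>PGL n\<^esub> g = proj_class E"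
    unfolding conjugate_in_def by auto
  have a: "proj_class A \<in> carrier (PGL n)" using A by (simp add: PGL_carrier)
  have "g \<otimes>\<^bsub>PGL n\<^esub> proj_class A = proj_class E \<otimes>\<^bsub>PGL n\<^esub> g"
    unfolding eq[symmetric] using g a by (simp add: m_assoc)
  moreover obtain G where G: "G \<in> GL_set n" "g = proj_class G" using g by (auto simp: PGL_carrier)
  ultimately have "proj_class (G * A) = proj_class (E * G)"
    using A E by (simp add: PGL_mult GL_set_carrier)
  then show ?thesis using that G by (auto simp: proj_class_eq_iff)
qed

section \<open>Closed conditions on commutators and connectedness\<close>

lemma poly_fun_sum:
  "(\<And>k. k \<in> I \<Longrightarrow> f k \<in> poly_fun n) \<Longrightarrow> (\<lambda>A. \<Sum>k\<in>I. f k A) \<in> poly_fun n"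
proof (induction I rule: infinite_finite_induct)
  case (insert x F)
  then show ?case using poly_fun.add[of "f x" n "\<lambda>A. \<Sum>k\<in>F. f k A"] by simp
qed (simp_all add: poly_fun.const)

text \<open>The equation is linear and homogeneous in the entries of \<open>B\<close>. Linearity
  makes the solutions a zero set of polynomials, homogeneity makes them a union of scalar classes,
  as the quotient topology requires.\<close>

lemma PGL_closed_quasi_commuting:
  fixes A :: "'a::field mat"
  assumes A: "A \<in> carrier_mat n n"
  shows "PGL_closed n (proj_class ` {B \<in> GL_set n. B * A = c \<cdot>\<^sub>m (A * B)})"
    (is "PGL_closed n (_ ` ?S)")
proof -
  define f where "f i j B = (\<Sum>k<n. B $$ (i,k) * A $$ (k,j)) + (-c) * (\<Sum>k<n. A $$ (i,k) * B $$ (k,j))"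
    for i j B
  have f: "f i j \<in> poly_fun n" if "i < n" "j < n" for i j
    unfolding f_def using that
    by (intro poly_fun.add poly_fun.mult poly_fun_sum poly_fun.const poly_fun.entry) auto
  have fB: "f i j B = (B * A) $$ (i,j) - (c \<cdot>\<^sub>m (A * B)) $$ (i,j)"
    if "i < n" "j < n" "B \<in> carrier_mat n n" for i j B
    using that A by (simp add: f_def scalar_prod_def atLeast0LessThan)
  have "?S = {B \<in> GL_set n. \<forall>g \<in> (\<Union>i<n. \<Union>j<n. {f i j}). g B = 0}"
  proof (intro Collect_cong conj_cong refl)
    fix B :: "'a mat" assume "B \<in> GL_set n"
    then have B: "B \<in> carrier_mat n n" by (rule GL_set_carrier)
    then have "(B * A = c \<cdot>\<^sub>m (A * B)) = (\<forall>i<n. \<forall>j<n. f i j B = 0)"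
      using A by (auto simp: fB mat_eq_iff)
    then show "(B * A = c \<cdot>\<^sub>m (A * B)) = (\<forall>g \<in> (\<Union>i<n. \<Union>j<n. {f i j}). g B = 0)" by auto
  qed
  then have closed: "GL_closed n ?S" unfolding GL_closed_def
    using f by (intro exI[of _ "\<Union>i<n. \<Union>j<n. {f i j}"]) auto
  have "C \<in> ?S" if BC: "B \<in> ?S" "C \<in> proj_class B" for B C
  proof -
    obtain d where d: "d \<noteq> 0" "C = d \<cdot>\<^sub>m B" using BC(2) by (auto simp: proj_class_def)
    have B: "B \<in> carrier_mat n n" using BC by (auto simp: GL_set_carrier)
    have "C * A = d \<cdot>\<^sub>m (B * A)" "A * C = d \<cdot>\<^sub>m (A * B)"
      using A B d by (auto simp: mult_smult_distrib[of _ n n _ n] mult_smult_assoc_mat[of _ n n _ n])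
    then show ?thesis using BC d by (auto simp: GL_set_smult smult_smult_mat mult.commute)
  qed
  then have "\<Union>(proj_class ` ?S) = ?S" using proj_class_self by blast
  then show ?thesis using closed by (auto simp: PGL_closed_def PGL_carrier)
qed

text \<open>An invertible matrix of positive size has a nonzero entry, where the scalars can be
  compared. The empty matrix has determinant 1, hence \<open>n > 0\<close>.\<close>

lemma smult_mat_cancel:
  assumes "c \<cdot>\<^sub>m A = d \<cdot>\<^sub>m A" "A \<in> GL_set n" "n > 0"
  shows "c = (d :: 'a::field)"
proof (rule ccontr)
  assume "c \<noteq> d"
  have A: "A \<in> carrier_mat n n" using assms by (simp add: GL_set_carrier)
  have "A $$ (i,j) = 0" if "i < n" "j < n" for i j
    using arg_cong[OF assms(1), of "\<lambda>M. M $$ (i,j)"] A that \<open>c \<noteq> d\<close> by auto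
  then have "A = 0\<^sub>m n n" using A by (intro eq_matI) auto
  then show False using assms by (auto simp: GL_set_def)
qed

lemma PGL_commute_iff:
  assumes "A \<in> GL_set n" "B \<in> GL_set n"
  shows "proj_class B \<otimes>\<^bsub>PGL n\<^esub> proj_class A = proj_class A \<otimes>\<^bsub>PGL n\<^esub> proj_class B
    \<longleftrightarrow> (\<exists>c. c \<noteq> 0 \<and> B * A = c \<cdot>\<^sub>m (A * B))"
  using assms by (simp add: PGL_mult GL_set_carrier proj_class_eq_iff)

text \<open>Moving \<open>B\<close> past \<open>A\<close> twice costs the factor
  \<open>c * c\<close>, but \<open>A\<close> squares to the identity and so gives back
  \<open>B\<close> itself.\<close>

lemma quasi_commuting_involution:
  assumes A: "A \<in> GL_set n" "A * A = 1\<^sub>m n" and B: "B \<in> GL_set n" and n: "n > 0"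
    and comm: "B * A = c \<cdot>\<^sub>m (A * B)"
  shows "c = 1 \<or> c = (-1 :: 'a::field)"
proof -
  have cA: "A \<in> carrier_mat n n" and cB: "B \<in> carrier_mat n n" using A B by (auto simp: GL_set_carrier)
  have "B = B * (A * A)" using A cB by simp
  also have "\<dots> = (B * A) * A" using cA cB by simp
  also have "\<dots> = c \<cdot>\<^sub>m (A * (B * A))"
    using cA cB by (simp add: comm mult_smult_assoc_mat[of _ n n _ n] del: assoc_mult_mat)
      (simp add: comm)
  also have "\<dots> = (c * c) \<cdot>\<^sub>m (A * A * B)"
    unfolding comm using cA cB by (simp add: mult_smult_distrib[of _ n n _ n] smult_smult_mat)
  finally have "1 \<cdot>\<^sub>m B = (c * c) \<cdot>\<^sub>m B" using A cB by simp
  from smult_mat_cancel[OF this B n] show ?thesis by (simp add: square_eq_1_iff)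
qed

text \<open>The commutator of the lifts with an involutory matrix is a sign depending continuously on the
  class, hence constant on connected sets.\<close>

lemma PGL_connected_commuting_lifts:
  fixes A :: "'a::field mat"
  assumes char: "(2::'a) \<noteq> 0" and n: "n > 0"
    and S: "PGL_connected n S" "S \<subseteq> carrier (PGL n)" "\<one>\<^bsub>PGL n\<^esub> \<in> S"
    and A: "A \<in> GL_set n" "A * A = 1\<^sub>m n"
    and comm: "\<And>x. x \<in> S \<Longrightarrow> x \<otimes>\<^bsub>PGL n\<^esub> proj_class A = proj_class A \<otimes>\<^bsub>PGL n\<^esub> x"
    and B: "B \<in> GL_set n" "proj_class B \<in> S"
  shows "B * A = A * B"
proof (rule ccontr)
  assume neq: "B * A \<noteq> A * B"
  \<comment> \<open>\<open>C 1\<close> and \<open>C (-1)\<close> consist of the classes whose lifts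
    commute, respectively anticommute, with \<open>A\<close>. These closed sets will disconnect
    \<open>S\<close>.\<close>
  define C where "C c = proj_class ` {B \<in> GL_set n. B * A = c \<cdot>\<^sub>m (A * B)}" for c
  have cA: "A \<in> carrier_mat n n" using A by (simp add: GL_set_carrier)
  have sign: "X * A = 1 \<cdot>\<^sub>m (A * X) \<or> X * A = (-1) \<cdot>\<^sub>m (A * X)"
    if X: "X \<in> GL_set n" "proj_class X \<in> S" for X
  proof -
    obtain c where "X * A = c \<cdot>\<^sub>m (A * X)" using comm[OF X(2)] PGL_commute_iff[OF A(1) X(1)] by auto
    then show ?thesis using quasi_commuting_involution[OF A X(1) n] by metis
  qed
  have closed: "PGL_closed n (C c)" for c
    unfolding C_def by (rule PGL_closed_quasi_commuting[OF cA])
  have cover: "S \<subseteq> C 1 \<union> C (-1)"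
  proof
    fix x assume x: "x \<in> S"
    then obtain X where "X \<in> GL_set n" "x = proj_class X" using S by (auto simp: PGL_carrier)
    then show "x \<in> C 1 \<union> C (-1)" using sign[of X] x unfolding C_def by auto
  qed
  \<comment> \<open>Rescaling a lift does not change the sign, and the two signs differ because the
    characteristic is not 2.\<close>
  have disj: "C 1 \<inter> C (-1) = {}"
  proof (rule ccontr)
    assume "C 1 \<inter> C (-1) \<noteq> {}"
    then obtain X Y where X: "X \<in> GL_set n" "X * A = 1 \<cdot>\<^sub>m (A * X)" and Y: "Y \<in> GL_set n"
      "Y * A = (-1) \<cdot>\<^sub>m (A * Y)" and XY: "proj_class Y = proj_class X" unfolding C_def by auto
    obtain d where d: "d \<noteq> 0" "Y = d \<cdot>\<^sub>m X" using XY by (auto simp: proj_class_eq_iff)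
    have cX: "X \<in> carrier_mat n n" using X by (simp add: GL_set_carrier)
    have "d \<cdot>\<^sub>m (A * X) = (- d) \<cdot>\<^sub>m (A * X)"
      using Y(2) X(2) cX cA unfolding d
      by (simp add: mult_smult_distrib[of _ n n _ n] mult_smult_assoc_mat[of _ n n _ n] smult_smult_mat)
    then have "d = - d" using smult_mat_cancel[OF _ GL_set_mult[OF A(1) X(1)] n] by blast
    then have "2 * d = 0" by (metis add.right_inverse mult_2)
    then show False using d char by simp
  qed
  have "\<one>\<^bsub>PGL n\<^esub> \<in> C 1"
    unfolding C_def PGL_one using cA by (intro imageI) (auto simp: GL_set_one)
  moreover have "proj_class B \<in> C (-1)"
    unfolding C_def using neq sign[OF B] B by (intro imageI) auto
  ultimately have "C 1 \<inter> S \<noteq> {}" "C (-1) \<inter> S \<noteq> {}" using S B by auto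
  then show False using S(1) closed cover disj unfolding PGL_connected_def by blast
qed

subsection \<open>Binary codes of constant weight\<close>

text \<open>Subsets are binary words and \<open>sym_diff\<close> is their addition. Adding a word
  \<open>B\<close> with \<open>h B\<close> permutes \<open>F\<close> and flips every sign, so the
  sum equals its own negative.\<close>

lemma sum_sign_character:
  fixes F :: "'b set set"
  assumes fin: "finite F" and sym: "\<And>S T. S \<in> F \<Longrightarrow> T \<in> F \<Longrightarrow> sym_diff S T \<in> F"
    and h: "\<And>S T. S \<in> F \<Longrightarrow> T \<in> F \<Longrightarrow> h (sym_diff S T) \<longleftrightarrow> h S \<noteq> h T"
  shows "(\<Sum>S\<in>F. if h S then -1 else 1 :: int) = (if \<forall>S\<in>F. \<not> h S then int (card F) else 0)"
proof (cases "\<forall>S\<in>F. \<not> h S")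
  case True
  then have "(\<Sum>S\<in>F. if h S then -1 else 1 :: int) = (\<Sum>S\<in>F. 1)" by (intro sum.cong) auto
  then show ?thesis using True by simp
next
  case False
  then obtain B where B: "B \<in> F" "h B" by auto
  let ?e = "\<lambda>S. if h S then -1 else 1 :: int"
  have invol: "sym_diff B (sym_diff B S) = S" for S by auto
  have "sum ?e F = (\<Sum>S\<in>F. ?e (sym_diff B S))"
    by (rule sum.reindex_bij_witness[where i = "sym_diff B" and j = "sym_diff B"])
      (use B sym invol in auto)
  also have "\<dots> = (\<Sum>S\<in>F. - ?e S)" using B h by (intro sum.cong) auto
  finally have "sum ?e F = - sum ?e F" by (simp add: sum_negf)
  then show ?thesis using False by auto
qed

text \<open>Orthogonality of characters: the sign functions of the coordinates are characters of the code,
  and their sum vanishes off the two constant words.\<close>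

lemma card_coordinates_with_character:
  fixes F :: "nat set set"
  assumes F: "F \<subseteq> Pow {..<n}" "{..<n} \<in> F" and n: "n > 0"
    and sym: "\<And>S T. S \<in> F \<Longrightarrow> T \<in> F \<Longrightarrow> sym_diff S T \<in> F"
    and weight: "\<And>S. S \<in> F \<Longrightarrow> S \<noteq> {} \<Longrightarrow> S \<noteq> {..<n} \<Longrightarrow> 2 * card S = n"
    and l: "\<And>S T. S \<in> F \<Longrightarrow> T \<in> F \<Longrightarrow> l (sym_diff S T) \<longleftrightarrow> l S \<noteq> l T" "l {..<n}"
  shows "card {i\<in>{..<n}. \<forall>S\<in>F. i \<in> S \<longleftrightarrow> l S} * card F = 2 * n"
proof -
  let ?e = "\<lambda>p. if p then -1 else 1 :: int"
  have fin: "finite F" using F finite_subset by blast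
  have e0: "{} \<in> F" using sym[OF F(2) F(2)] by simp
  have l0: "\<not> l {}" using l(1)[OF e0 e0] by simp
  \<comment> \<open>The product of two characters is a character, trivial exactly when they agree;
    so this sum detects the coordinates to be counted.\<close>
  have inner: "(\<Sum>S\<in>F. ?e (i \<in> S) * ?e (l S)) = (if \<forall>S\<in>F. i \<in> S \<longleftrightarrow> l S then int (card F) else 0)" for i
  proof -
    have "(\<Sum>S\<in>F. ?e (i \<in> S) * ?e (l S)) = (\<Sum>S\<in>F. ?e ((i \<in> S) \<noteq> l S))"
      by (intro sum.cong) auto
    also have "\<dots> = (if \<forall>S\<in>F. \<not> ((i \<in> S) \<noteq> l S) then int (card F) else 0)"
      by (rule sum_sign_character[OF fin sym]) (auto simp: l(1))
    finally show ?thesis by simp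
  qed
  have col: "(\<Sum>i<n. ?e (i \<in> S)) = int n - 2 * int (card S)" if "S \<in> F" for S
  proof -
    have S: "S \<subseteq> {..<n}" using that F by auto
    have "(\<Sum>i<n. ?e (i \<in> S)) = (\<Sum>i<n. 1 - 2 * (if i \<in> S then 1 else 0))"
      by (intro sum.cong) auto
    also have "\<dots> = int n - 2 * (\<Sum>i<n. if i \<in> S then 1 else 0)"
      by (simp add: sum_subtractf sum_distrib_left)
    also have "(\<Sum>i<n. if i \<in> S then 1 else 0 :: int) = int (card ({..<n} \<inter> S))"
      by (simp add: sum.If_cases)
    finally show ?thesis using S by (simp add: Int_absorb1)
  qed
  \<comment> \<open>Double counting: summing over words first gives the wanted number, summing over
    coordinates first gives \<open>n\<close> minus twice the weight of each word, which vanishes at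
    weight n/2.\<close>
  have "int (card {i\<in>{..<n}. \<forall>S\<in>F. i \<in> S \<longleftrightarrow> l S} * card F)
      = (\<Sum>i<n. if \<forall>S\<in>F. i \<in> S \<longleftrightarrow> l S then int (card F) else 0)"
    by (simp add: sum.If_cases Int_def)
  also have "\<dots> = (\<Sum>i<n. \<Sum>S\<in>F. ?e (i \<in> S) * ?e (l S))" by (simp only: inner)
  also have "\<dots> = (\<Sum>S\<in>F. \<Sum>i<n. ?e (i \<in> S) * ?e (l S))" by (rule sum.swap)
  also have "\<dots> = (\<Sum>S\<in>F. (int n - 2 * int (card S)) * ?e (l S))"
    by (intro sum.cong refl, subst sum_distrib_right[symmetric], simp only: col)
  also have "\<dots> = (\<Sum>S\<in>{{}, {..<n}}. (int n - 2 * int (card S)) * ?e (l S))"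
  proof (rule sum.mono_neutral_right[OF fin])
    show "{{}, {..<n}} \<subseteq> F" using e0 F by auto
    show "\<forall>S\<in>F - {{}, {..<n}}. (int n - 2 * int (card S)) * ?e (l S) = 0"
      using weight by (fastforce simp del: of_nat_mult)
  qed
  \<comment> \<open>The zero word contributes \<open>n\<close>. The all-one word contributes
    \<open>-n\<close> times the sign -1, which is again \<open>n\<close>.\<close>
  also have "\<dots> = int (2 * n)"
  proof -
    have "{} \<noteq> {..<n}" using n by (auto simp: set_eq_iff)
    then show ?thesis using l(2) l0 by (subst sum.insert) auto
  qed
  finally show ?thesis by (simp only: of_nat_eq_iff)
qed

text \<open>The coordinate characters and their translates by the quotient of the coordinates
  \<open>a\<close> and \<open>b\<close> take every character that is -1 at the all-one word equally
  often. So the two families agree as multisets, and a permutation matches them.\<close>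

lemma code_translation_permutation:
  fixes F :: "nat set set"
  assumes F: "F \<subseteq> Pow {..<n}" "{..<n} \<in> F" and ab: "a < n" "b < n"
    and sym: "\<And>S T. S \<in> F \<Longrightarrow> T \<in> F \<Longrightarrow> sym_diff S T \<in> F"
    and weight: "\<And>S. S \<in> F \<Longrightarrow> S \<noteq> {} \<Longrightarrow> S \<noteq> {..<n} \<Longrightarrow> 2 * card S = n"
  obtains p where "p permutes {..<n}"
    and "\<And>i S. i < n \<Longrightarrow> S \<in> F \<Longrightarrow> p i \<in> S \<longleftrightarrow> (i \<in> S) \<noteq> ((a \<in> S) \<noteq> (b \<in> S))"
proof -
  \<comment> \<open>A character is recorded by the set of words where it is -1: \<open>k i\<close>
    for coordinate \<open>i\<close>, \<open>k' i\<close> for its translate.\<close>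
  define k where "k i = {S\<in>F. i \<in> S}" for i
  define k' where "k' i = {S\<in>F. (i \<in> S) \<noteq> ((a \<in> S) \<noteq> (b \<in> S))}" for i
  have n: "n > 0" using ab by simp
  have fin: "finite F" using F finite_subset by blast
  \<comment> \<open>These sets \<open>K\<close> stand for the characters of the code that are -1 at
    the all-one word. Translation preserves the latter condition, as the signs at \<open>a\<close>
    and \<open>b\<close> cancel there.\<close>
  define char where "char K \<longleftrightarrow> K \<subseteq> F \<and> {..<n} \<in> K \<and>
      (\<forall>S\<in>F. \<forall>T\<in>F. sym_diff S T \<in> K \<longleftrightarrow> (S \<in> K) \<noteq> (T \<in> K))" for K
  have k_char: "char (k i)" if "i < n" for i
    using that F sym unfolding char_def k_def by auto
  have k'_char: "char (k' i)" if "i < n" for i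
    unfolding char_def
  proof (intro conjI ballI)
    show "{..<n} \<in> k' i" using that F ab by (simp add: k'_def)
    fix S T assume ST: "S \<in> F" "T \<in> F"
    then show "sym_diff S T \<in> k' i \<longleftrightarrow> (S \<in> k' i) \<noteq> (T \<in> k' i)"
      using sym[OF ST] unfolding k'_def by auto
  qed (auto simp: k'_def)
  have card_k: "card {i\<in>{..<n}. k i = K} * card F = 2 * n" if "char K" for K
  proof -
    have "{i\<in>{..<n}. k i = K} = {i\<in>{..<n}. \<forall>S\<in>F. i \<in> S \<longleftrightarrow> S \<in> K}"
      using that unfolding char_def k_def by auto
    then show ?thesis
      using card_coordinates_with_character[OF F n sym weight, where l = "\<lambda>S. S \<in> K"] that
      unfolding char_def by simp
  qed
  have card_k': "card {i\<in>{..<n}. k' i = K} * card F = 2 * n" if "char K" for K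
  proof -
    \<comment> \<open>\<open>l\<close> is \<open>K\<close> translated back, so
      \<open>k' i = K\<close> says that coordinate \<open>i\<close> is the character
      \<open>l\<close>.\<close>
    define l where "l S \<longleftrightarrow> (S \<in> K) \<noteq> ((a \<in> S) \<noteq> (b \<in> S))" for S
    have "{i\<in>{..<n}. k' i = K} = {i\<in>{..<n}. \<forall>S\<in>F. i \<in> S \<longleftrightarrow> l S}"
      using that unfolding char_def k'_def l_def by auto
    moreover have "l {..<n}" using that ab by (simp add: l_def char_def)
    moreover have "l (sym_diff S T) \<longleftrightarrow> l S \<noteq> l T" if "S \<in> F" "T \<in> F" for S T
    proof -
      have "sym_diff S T \<in> K \<longleftrightarrow> (S \<in> K) \<noteq> (T \<in> K)" using \<open>char K\<close> that unfolding char_def by blast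
      then show ?thesis unfolding l_def by auto
    qed
    ultimately show ?thesis
      using card_coordinates_with_character[OF F n sym weight, where l = l] by simp
  qed
  have count: "count (mset (map f [0..<n])) K = card {i\<in>{..<n}. f i = K}" for f :: "nat \<Rightarrow> nat set set" and K
  proof -
    have "count (mset (map f [0..<n])) K = length (filter (\<lambda>x. K = f x) [0..<n])"
      by (simp only: count_mset count_list_eq_length_filter filter_map comp_def length_map)
    also have "\<dots> = card (set (filter (\<lambda>x. K = f x) [0..<n]))"
      by (rule distinct_card[symmetric]) simp
    also have "set (filter (\<lambda>x. K = f x) [0..<n]) = {i\<in>{..<n}. f i = K}" by auto
    finally show ?thesis .
  qed
  have "mset (map k' [0..<n]) = mset (map k [0..<n])"
  proof (rule multiset_eqI)
    fix K
    have pos: "card F > 0" using F fin card_gt_0_iff by blast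
    have "card {i\<in>{..<n}. k' i = K} = card {i\<in>{..<n}. k i = K}"
    proof (cases "char K")
      case True
      then have "card {i\<in>{..<n}. k' i = K} * card F = card {i\<in>{..<n}. k i = K} * card F"
        by (simp only: card_k card_k')
      then show ?thesis using pos by simp
    next
      case False
      then have "{i\<in>{..<n}. k' i = K} = {}" "{i\<in>{..<n}. k i = K} = {}"
        using k_char k'_char by blast+
      then show ?thesis by (simp only:)
    qed
    then show "count (mset (map k' [0..<n])) K = count (mset (map k [0..<n])) K"
      by (simp only: count)
  qed
  then obtain p where p: "p permutes {..<n}" "permute_list p (map k [0..<n]) = map k' [0..<n]"
    by (rule mset_eq_permutation) simp
  have "k (p i) = k' i" if "i < n" for i
  proof -
    have "p i < n" using permutes_in_image[OF p(1), of i] that by simp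
    moreover have "permute_list p (map k [0..<n]) ! i = map k [0..<n] ! p i"
      using that p(1) by (intro permute_list_nth) auto
    ultimately show ?thesis using that p(2) by simp
  qed
  then show ?thesis using that[OF p(1)] unfolding k_def k'_def by blast
qed

subsection \<open>Commuting involutory matrices\<close>

lemma replace_col_carrier [simp]: "P \<in> carrier_mat n m \<Longrightarrow> replace_col P w j \<in> carrier_mat n m"
  by (simp add: replace_col_def)

lemma col_replace_col:
  assumes "P \<in> carrier_mat n m" "w \<in> carrier_vec n" "k < m"
  shows "col (replace_col P w j) k = (if k = j then w else col P k)"
  using assms by (intro eq_vecI) (auto simp: replace_col_def)

text \<open>Laplace expansion along column \<open>j\<close>, whose cofactors do not see the replaced
  column. The formula makes linearity in \<open>w\<close> visible.\<close>

lemma det_replace_col: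
  assumes P: "P \<in> carrier_mat n n" and j: "j < n"
  shows "det (replace_col P w j) = (\<Sum>i<n. w $ i * cofactor P i j)"
proof -
  have "cofactor (replace_col P w j) i j = cofactor P i j" if "i < n" for i
  proof -
    have "mat_delete (replace_col P w j) i j = mat_delete P i j"
      using P j that unfolding mat_delete_def replace_col_def by (intro eq_matI) auto
    then show ?thesis by (simp add: cofactor_def)
  qed
  then show ?thesis
    using laplace_expansion_column[OF replace_col_carrier[OF P] j, of w j] P j
    by (simp add: replace_col_def)
qed

definition sign_eigenvector :: "'a::ring_1 mat \<Rightarrow> 'a vec \<Rightarrow> bool" where
  "sign_eigenvector X w \<longleftrightarrow> X *\<^sub>v w = w \<or> X *\<^sub>v w = - w"

text \<open>The determinants obtained from the columns \<open>w + X w\<close> and \<open>w - X w\<close> add up to twice the one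
  obtained from \<open>w\<close>, so one of these two eigenvectors of \<open>X\<close> can replace \<open>w\<close>.\<close>

lemma ex_replace_col_common_eigenvector:
  fixes P :: "'a::field mat"
  assumes char: "(2::'a) \<noteq> 0" and fin: "finite F"
    and F: "\<And>X. X \<in> F \<Longrightarrow> X \<in> carrier_mat n n \<and> X * X = 1\<^sub>m n"
    and comm: "\<And>X Y. X \<in> F \<Longrightarrow> Y \<in> F \<Longrightarrow> X * Y = Y * X"
    and P: "P \<in> carrier_mat n n" "det P \<noteq> 0" and j: "j < n"
  shows "\<exists>w\<in>carrier_vec n. det (replace_col P w j) \<noteq> 0 \<and> (\<forall>X\<in>F. sign_eigenvector X w)"
  using fin F comm
proof (induction F)
  case empty
  have "replace_col P (col P j) j = P" using P j by (intro eq_matI) (auto simp: replace_col_def)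
  then show ?case using P j by (intro bexI[of _ "col P j"]) auto
next
  case (insert X F)
  from insert.IH insert.prems obtain w where w: "w \<in> carrier_vec n" "det (replace_col P w j) \<noteq> 0"
    "\<And>Y. Y \<in> F \<Longrightarrow> sign_eigenvector Y w" by auto
  have X: "X \<in> carrier_mat n n" "X * X = 1\<^sub>m n" using insert.prems by auto
  define z where "z = X *\<^sub>v w"
  have z: "z \<in> carrier_vec n" using X w by (simp add: z_def)
  have Xz: "X *\<^sub>v z = w" using X w by (simp add: z_def flip: assoc_mult_mat_vec)
  \<comment> \<open>As \<open>Y\<close> commutes with \<open>X\<close>, it acts on \<open>z\<close>
    with the same sign as on \<open>w\<close>, hence also on \<open>w + z\<close> and
    \<open>w - z\<close>.\<close>
  have Yz: "Y *\<^sub>v w = w \<and> Y *\<^sub>v z = z \<or> Y *\<^sub>v w = -w \<and> Y *\<^sub>v z = -z" if Y: "Y \<in> F" for Y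
  proof -
    have cY: "Y \<in> carrier_mat n n" using insert.prems Y by auto
    have "Y *\<^sub>v z = (Y * X) *\<^sub>v w" using X cY w by (simp add: z_def)
    also have "\<dots> = X *\<^sub>v (Y *\<^sub>v w)" using X cY w insert.prems(2)[of Y X] Y by simp
    finally show ?thesis using w(3)[OF Y] X w(1) cY unfolding sign_eigenvector_def z_def by auto
  qed
  have "det (replace_col P (w + z) j) + det (replace_col P (w - z) j) = 2 * det (replace_col P w j)"
    unfolding det_replace_col[OF P(1) j] sum_distrib_left sum.distrib[symmetric]
    using w z by (intro sum.cong) (auto simp: algebra_simps)
  then have "det (replace_col P (w + z) j) \<noteq> 0 \<or> det (replace_col P (w - z) j) \<noteq> 0"
    using w char by auto
  then show ?case
  proof
    assume "det (replace_col P (w + z) j) \<noteq> 0"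
    moreover have "sign_eigenvector X (w + z)"
      using X w(1) z Xz by (simp add: sign_eigenvector_def mult_add_distrib_mat_vec[of _ n n]
          comm_add_vec[of z n] flip: z_def)
    moreover have "sign_eigenvector Y (w + z)" if "Y \<in> F" for Y
    proof -
      have "Y \<in> carrier_mat n n" using insert.prems that by auto
      then show ?thesis using Yz[OF that] w z
        by (auto simp: sign_eigenvector_def mult_add_distrib_mat_vec[of _ n n])
    qed
    ultimately show ?thesis using w z by (intro bexI[of _ "w + z"]) auto
  next
    assume "det (replace_col P (w - z) j) \<noteq> 0"
    moreover have "sign_eigenvector X (w - z)"
      using X w(1) z Xz by (auto simp: sign_eigenvector_def mult_minus_distrib_mat_vec[of _ n n] simp flip: z_def)
    moreover have "sign_eigenvector Y (w - z)" if "Y \<in> F" for Y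
    proof -
      have "Y \<in> carrier_mat n n" using insert.prems that by auto
      then show ?thesis using Yz[OF that] w z
        by (auto simp: sign_eigenvector_def mult_minus_distrib_mat_vec[of _ n n])
    qed
    ultimately show ?thesis using w z by (intro bexI[of _ "w - z"]) auto
  qed
qed

section \<open>Diagonal sign matrices and simultaneous diagonalization\<close>

definition sign_mat :: "nat \<Rightarrow> nat set \<Rightarrow> 'a::ring_1 mat" where
  "sign_mat n S = mat n n (\<lambda>(i, j). if i = j then (if i \<in> S then -1 else 1) else 0)"

lemma sign_mat_carrier [simp]: "sign_mat n S \<in> carrier_mat n n"
  by (simp add: sign_mat_def)

lemma sign_mat_dim [simp]: "dim_row (sign_mat n S) = n" "dim_col (sign_mat n S) = n"
  by (simp_all add: sign_mat_def)

lemma mult_sign_mat: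
  assumes "A \<in> carrier_mat n n"
  shows "A * sign_mat n S = mat n n (\<lambda>(i, j). if j \<in> S then - A $$ (i, j) else A $$ (i, j))"
proof (rule eq_matI)
  fix i j assume "i < dim_row (mat n n (\<lambda>(i, j). if j \<in> S then - A $$ (i, j) else A $$ (i, j)))"
    "j < dim_col (mat n n (\<lambda>(i, j). if j \<in> S then - A $$ (i, j) else A $$ (i, j)))"
  then have ij: "i < n" "j < n" by auto
  have "(A * sign_mat n S) $$ (i, j) = (\<Sum>k<n. A $$ (i, k) * sign_mat n S $$ (k, j))"
    using ij assms by (simp add: scalar_prod_def atLeast0LessThan sign_mat_def)
  also have "\<dots>
      = (\<Sum>k<n. if k = j then (if j \<in> S then - A $$ (i, j) else A $$ (i, j)) else 0)"
    using ij by (intro sum.cong) (auto simp: sign_mat_def)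
  finally show "(A * sign_mat n S) $$ (i, j)
      = mat n n (\<lambda>(i, j). if j \<in> S then - A $$ (i, j) else A $$ (i, j)) $$ (i, j)"
    using ij by simp
qed (use assms in auto)

lemma sign_mat_mult_left:
  assumes "A \<in> carrier_mat n n"
  shows "sign_mat n S * A = mat n n (\<lambda>(i, j). if i \<in> S then - A $$ (i, j) else A $$ (i, j))"
proof (rule eq_matI)
  fix i j assume "i < dim_row (mat n n (\<lambda>(i, j). if i \<in> S then - A $$ (i, j) else A $$ (i, j)))"
    "j < dim_col (mat n n (\<lambda>(i, j). if i \<in> S then - A $$ (i, j) else A $$ (i, j)))"
  then have ij: "i < n" "j < n" by auto
  have "(sign_mat n S * A) $$ (i, j) = (\<Sum>k<n. sign_mat n S $$ (i, k) * A $$ (k, j))"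
    using ij assms by (simp add: scalar_prod_def atLeast0LessThan sign_mat_def)
  also have "\<dots>
      = (\<Sum>k<n. if k = i then (if i \<in> S then - A $$ (i, j) else A $$ (i, j)) else 0)"
    using ij by (intro sum.cong) (auto simp: sign_mat_def)
  finally show "(sign_mat n S * A) $$ (i, j)
      = mat n n (\<lambda>(i, j). if i \<in> S then - A $$ (i, j) else A $$ (i, j)) $$ (i, j)"
    using ij by simp
qed (use assms in auto)

lemma sign_mat_mult: "sign_mat n S * sign_mat n T = sign_mat n (sym_diff S T)"
  unfolding mult_sign_mat[OF sign_mat_carrier] by (intro eq_matI) (auto simp: sign_mat_def)

lemma sign_mat_empty: "sign_mat n {} = 1\<^sub>m n"
  by (intro eq_matI) (auto simp: sign_mat_def)

lemma sign_mat_square: "sign_mat n S * sign_mat n S = 1\<^sub>m n"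
  by (simp add: sign_mat_mult sign_mat_empty)

lemma uminus_sign_mat: "(-1) \<cdot>\<^sub>m sign_mat n S = sign_mat n ({..<n} - S)"
  by (intro eq_matI) (auto simp: sign_mat_def)

lemma sign_mat_GL: "sign_mat n S \<in> GL_set n"
  by (rule GL_setI[OF _ _ sign_mat_square]) auto

lemma sign_mat_inj:
  assumes "(2::'a::field) \<noteq> 0" "sign_mat n S = (sign_mat n T :: 'a mat)" "S \<subseteq> {..<n}" "T \<subseteq> {..<n}"
  shows "S = T"
proof -
  have neq: "(1::'a) \<noteq> -1" using assms(1) by (metis add.right_inverse one_add_one)
  have "i \<in> S \<longleftrightarrow> i \<in> T" if "i < n" for i
    using arg_cong[OF assms(2), of "\<lambda>M. M $$ (i, i)"] that neq
    by (auto simp: sign_mat_def split: if_splits)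
  then show ?thesis using assms by blast
qed

text \<open>Starting from the identity matrix, the columns are exchanged one after the other for
  common eigenvectors while the determinant stays nonzero.\<close>

lemma simultaneous_sign_diagonalization:
  fixes F :: "'a::field mat set"
  assumes char: "(2::'a) \<noteq> 0" and fin: "finite F"
    and F: "\<And>X. X \<in> F \<Longrightarrow> X \<in> carrier_mat n n \<and> X * X = 1\<^sub>m n"
    and comm: "\<And>X Y. X \<in> F \<Longrightarrow> Y \<in> F \<Longrightarrow> X * Y = Y * X"
  obtains P s where "P \<in> GL_set n"
    and "\<And>X. X \<in> F \<Longrightarrow> s X \<subseteq> {..<n} \<and> X * P = P * sign_mat n (s X)"
proof -
  have "\<exists>P\<in>carrier_mat n n. det P \<noteq> 0 \<and> (\<forall>X\<in>F. \<forall>j<k. sign_eigenvector X (col P j))" if "k \<le> n" for k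
    using that
  proof (induction k)
    case 0
    then show ?case by (intro bexI[of _ "1\<^sub>m n"]) auto
  next
    case (Suc k)
    then obtain P where P: "P \<in> carrier_mat n n" "det P \<noteq> 0"
      and eig: "\<And>X j. X \<in> F \<Longrightarrow> j < k \<Longrightarrow> sign_eigenvector X (col P j)" by auto
    have k: "k < n" using Suc.prems by simp
    obtain w where w: "w \<in> carrier_vec n" "det (replace_col P w k) \<noteq> 0"
      "\<And>X. X \<in> F \<Longrightarrow> sign_eigenvector X w"
      using ex_replace_col_common_eigenvector[OF char fin F comm P k] by blast
    have "sign_eigenvector X (col (replace_col P w k) j)" if "X \<in> F" "j < Suc k" for X j
      using that k w eig by (auto simp: col_replace_col[OF P(1) w(1)] less_Suc_eq)
    then show ?case using w P by (intro bexI[of _ "replace_col P w k"]) auto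
  qed
  from this[of n] obtain P where P: "P \<in> carrier_mat n n" "det P \<noteq> 0"
    and eig: "\<And>X j. X \<in> F \<Longrightarrow> j < n \<Longrightarrow> sign_eigenvector X (col P j)" by auto
  \<comment> \<open>A column that is an eigenvector for a sign but not fixed by \<open>X\<close> is
    negated, so \<open>s X\<close> marks the entries -1.\<close>
  define s where "s X = {j. j < n \<and> X *\<^sub>v col P j \<noteq> col P j}" for X
  have "X * P = P * sign_mat n (s X)" if X: "X \<in> F" for X
    unfolding mult_sign_mat[OF P(1)]
  proof (rule eq_matI)
    have cX: "X \<in> carrier_mat n n" using F X by auto
    fix i j assume "i < dim_row (mat n n (\<lambda>(i, j). if j \<in> s X then - P $$ (i, j) else P $$ (i, j)))"
      "j < dim_col (mat n n (\<lambda>(i, j). if j \<in> s X then - P $$ (i, j) else P $$ (i, j)))"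
    then have ij: "i < n" "j < n" by auto
    have "X *\<^sub>v col P j = (if j \<in> s X then - col P j else col P j)"
      using eig[OF X ij(2)] ij by (auto simp: s_def sign_eigenvector_def)
    then have "(X *\<^sub>v col P j) $ i = (if j \<in> s X then - P $$ (i, j) else P $$ (i, j))"
      using ij P by auto
    then show "(X * P) $$ (i, j) = mat n n (\<lambda>(i, j). if j \<in> s X then - P $$ (i, j) else P $$ (i, j)) $$ (i, j)"
      using ij P cX by auto
  qed (use F[OF X] P in auto)
  then show ?thesis using that[of P s] P by (auto simp: GL_set_def s_def)
qed

text \<open>A finite subset can be diagonalized simultaneously, and each of its members is recovered
  from its sign pattern; this bounds its size by \<open>2 ^ n\<close> uniformly.\<close>

lemma finite_commuting_involutions:
  fixes F :: "'a::field mat set"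
  assumes char: "(2::'a) \<noteq> 0"
    and F: "\<And>X. X \<in> F \<Longrightarrow> X \<in> carrier_mat n n \<and> X * X = 1\<^sub>m n"
    and comm: "\<And>X Y. X \<in> F \<Longrightarrow> Y \<in> F \<Longrightarrow> X * Y = Y * X"
  shows "finite F"
proof -
  have "card G \<le> 2 ^ n" if G: "G \<subseteq> F" "finite G" for G
  proof -
    obtain P s where P: "P \<in> GL_set n"
      and s: "\<And>X. X \<in> G \<Longrightarrow> s X \<subseteq> {..<n} \<and> X * P = P * sign_mat n (s X)"
      by (rule simultaneous_sign_diagonalization[OF char G(2), of n]) (use F comm G in blast)+
    obtain R where R: "R \<in> GL_set n" "P * R = 1\<^sub>m n" using GL_set_inverse[OF P] by metis
    have "X = P * sign_mat n (s X) * R" if X: "X \<in> G" for X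
    proof -
      have "X \<in> carrier_mat n n" using X F G by auto
      then have "X = X * P * R" using R GL_set_carrier[OF P] GL_set_carrier[OF R(1)] by simp
      also have "X * P = P * sign_mat n (s X)" using s[OF X] by simp
      finally show ?thesis .
    qed
    then have "inj_on s G" by (intro inj_on_inverseI[where g = "\<lambda>S. P * sign_mat n S * R"]) simp
    then have "card G \<le> card (Pow {..<n})" using s by (intro card_inj_on_le) auto
    then show ?thesis by (simp add: card_Pow)
  qed
  then show ?thesis using finite_if_finite_subsets_card_bdd by blast
qed

section \<open>The multiplicity of the eigenvalue -1 as an invariant\<close>

lemma proots_prod_list_linear: "proots (\<Prod>a\<leftarrow>xs. [:- a, 1:]) = mset (xs :: 'a::field list)"
proof (induction xs)
  case (Cons a xs)
  have "(\<Prod>a\<leftarrow>xs. [:- a, 1:]) \<noteq> 0" by (auto simp: prod_list_zero_iff)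
  then have "proots ([:- a, 1:] * (\<Prod>a\<leftarrow>xs. [:- a, 1:])) = proots [:- a, 1:] + mset xs"
    unfolding Cons.IH[symmetric] by (intro proots_mult) auto
  then show ?case by (simp del: mult_pCons_left)
qed simp

text \<open>Similar matrices have the same characteristic polynomial, and its root -1 has
  multiplicity \<open>card S\<close>, respectively \<open>card T\<close>, because 1 and -1
  differ.\<close>

lemma similar_sign_mat_card:
  fixes G :: "'a::field mat"
  assumes char: "(2::'a) \<noteq> 0" and G: "G \<in> GL_set n" and ST: "S \<subseteq> {..<n}" "T \<subseteq> {..<n}"
    and eq: "G * sign_mat n S = sign_mat n T * G"
  shows "card S = card T"
proof -
  have neq: "(1::'a) \<noteq> -1" using char by (metis add.right_inverse one_add_one)
  obtain R where R: "R \<in> GL_set n" "G * R = 1\<^sub>m n" "R * G = 1\<^sub>m n" using GL_set_inverse[OF G] by metis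
  have c: "G \<in> carrier_mat n n" "R \<in> carrier_mat n n" using G R by (auto simp: GL_set_carrier)
  have "sign_mat n S = R * G * sign_mat n S" unfolding R by (simp add: left_mult_one_mat[of _ n n])
  also have "\<dots> = R * (sign_mat n T * G)" using c eq by (simp add: assoc_mult_mat[of _ n n _ n _ n])
  finally have "sign_mat n S = R * sign_mat n T * G" using c by (simp add: assoc_mult_mat[of _ n n _ n _ n])
  then have "similar_mat (sign_mat n S) (sign_mat n T :: 'a mat)"
    using c R unfolding similar_mat_def similar_mat_wit_def Let_def
    by (intro exI[of _ R] exI[of _ G]) (auto simp: sign_mat_def)
  then have "char_poly (sign_mat n S) = char_poly (sign_mat n T :: 'a mat)" by (rule char_poly_similar)
  moreover have "count (proots (char_poly (sign_mat n U :: 'a mat))) (-1) = card U" if "U \<subseteq> {..<n}" for U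
  proof -
    have "char_poly (sign_mat n U :: 'a mat) = (\<Prod>a\<leftarrow>diag_mat (sign_mat n U). [:- a, 1:])"
      by (rule char_poly_upper_triangular[of _ n]) (auto simp: sign_mat_def upper_triangular_def)
    then have "proots (char_poly (sign_mat n U :: 'a mat)) = mset (diag_mat (sign_mat n U))"
      by (simp only: proots_prod_list_linear)
    also have "count \<dots> (-1) = length (filter (\<lambda>i. i \<in> U) [0..<n])"
    proof -
      have "filter (\<lambda>i. -1 = (sign_mat n U :: 'a mat) $$ (i, i)) [0..<n] = filter (\<lambda>i. i \<in> U) [0..<n]"
        using neq by (intro filter_cong) (auto simp: sign_mat_def)
      then show ?thesis
        by (simp only: diag_mat_def count_mset count_list_eq_length_filter filter_map comp_def length_map)
          (simp add: sign_mat_def)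
    qed
    also have "\<dots> = card (set (filter (\<lambda>i. i \<in> U) [0..<n]))"
      by (rule distinct_card[symmetric]) simp
    also have "set (filter (\<lambda>i. i \<in> U) [0..<n]) = U" using that by auto
    finally show ?thesis .
  qed
  ultimately show ?thesis using ST by metis
qed

text \<open>Applying the equation twice gives \<open>c * c = 1\<close>. The sign -1 merely replaces
  \<open>{..<n div 2}\<close> by its complement, which has the same size since \<open>n\<close> is
  even.\<close>

lemma projectively_similar_balanced_sign_mat_card:
  fixes G :: "'a::field mat"
  assumes char: "(2::'a) \<noteq> 0" and G: "G \<in> GL_set n" and S: "S \<subseteq> {..<n}" and n: "even n" "n > 0"
    and eq: "G * sign_mat n S = c \<cdot>\<^sub>m (sign_mat n {..<n div 2} * G)"
  shows "2 * card S = n"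
proof -
  have cG: "G \<in> carrier_mat n n" using G by (simp add: GL_set_carrier)
  define E where "E = (sign_mat n {..<n div 2} :: 'a mat)"
  have cE: "E \<in> carrier_mat n n" by (simp add: E_def)
  have "G = G * (sign_mat n S * sign_mat n S)" using cG by (simp add: sign_mat_square)
  also have "\<dots> = c \<cdot>\<^sub>m (E * G) * sign_mat n S"
    using cG by (simp add: E_def assoc_mult_mat[of _ n n _ n _ n] flip: eq)
  also have "\<dots> = c \<cdot>\<^sub>m (E * (c \<cdot>\<^sub>m (E * G)))"
    using cG cE eq by (simp add: mult_smult_assoc_mat[of _ n n _ n] assoc_mult_mat[of _ n n _ n _ n] flip: E_def)
  also have "\<dots> = (c * c) \<cdot>\<^sub>m (E * E * G)"
    using cG cE by (simp add: mult_smult_distrib[of _ n n _ n] smult_smult_mat)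
  finally have "1 \<cdot>\<^sub>m G = (c * c) \<cdot>\<^sub>m G" using cG by (simp add: E_def sign_mat_square)
  from smult_mat_cancel[OF this G n(2)] have "c = 1 \<or> c = -1" by (simp add: square_eq_1_iff)
  then show ?thesis
  proof
    assume "c = 1"
    then have "card S = card {..<n div 2}"
      using eq by (intro similar_sign_mat_card[OF char G S]) auto
    then show ?thesis using n by simp
  next
    assume "c = -1"
    then have "G * sign_mat n S = sign_mat n ({..<n} - {..<n div 2}) * G"
      unfolding uminus_sign_mat[symmetric] using eq cG by (simp add: mult_smult_assoc_mat[of _ n n _ n])
    then have "card S = card ({..<n} - {..<n div 2})"
      by (intro similar_sign_mat_card[OF char G S]) auto
    also have "\<dots> = n - n div 2" by (subst card_Diff_subset) auto
    finally show ?thesis using n by auto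
  qed
qed

subsection \<open>The element outside the identity component\<close>

definition perm_mat :: "nat \<Rightarrow> (nat \<Rightarrow> nat) \<Rightarrow> 'a::field mat" where
  "perm_mat n p = mat n n (\<lambda>(i, j). if i = p j then 1 else 0)"

lemma perm_mat_carrier [simp]: "perm_mat n p \<in> carrier_mat n n"
  by (simp add: perm_mat_def)

lemma perm_mat_GL:
  assumes p: "p permutes {..<n}"
  shows "perm_mat n p \<in> (GL_set n :: 'a::field mat set)"
proof (rule GL_setI)
  let ?N = "mat n n (\<lambda>(j, k). if k = p j then 1 else 0) :: 'a mat"
  show "perm_mat n p * ?N = 1\<^sub>m n"
  proof (rule eq_matI)
    fix i k assume "i < dim_row (1\<^sub>m n :: 'a mat)" "k < dim_col (1\<^sub>m n :: 'a mat)"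
    then have ik: "i < n" "k < n" by auto
    define f where "f j = (if i = j then 1 else 0) * (if k = j then 1 else 0 :: 'a)" for j
    have "(perm_mat n p * ?N) $$ (i, k) = (\<Sum>j<n. (f \<circ> p) j)"
      using ik by (simp add: perm_mat_def scalar_prod_def atLeast0LessThan f_def)
    also have "\<dots> = (\<Sum>j<n. f j)" by (rule sum.permute[OF p, symmetric])
    also have "\<dots> = (\<Sum>j<n. if j = i then (if i = k then 1 else 0) else 0)"
      by (intro sum.cong) (auto simp: f_def)
    also have "\<dots> = 1\<^sub>m n $$ (i, k)" using ik by simp
    finally show "(perm_mat n p * ?N) $$ (i, k) = 1\<^sub>m n $$ (i, k)" .
  qed (auto simp: perm_mat_def)
qed auto

text \<open>The nonzero entry at \<open>(p j, j)\<close> receives the sign of \<open>j\<close> on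
  the left side and the sign of \<open>p j\<close> on the right side; these differ exactly if
  \<open>q\<close> holds.\<close>

lemma perm_mat_mult_sign_mat:
  assumes "p permutes {..<n}" "\<And>i. i < n \<Longrightarrow> p i \<in> S \<longleftrightarrow> (i \<in> S) \<noteq> q"
  shows "perm_mat n p * sign_mat n S = (if q then -1 else 1) \<cdot>\<^sub>m (sign_mat n S * perm_mat n p)"
  unfolding mult_sign_mat[OF perm_mat_carrier] sign_mat_mult_left[OF perm_mat_carrier]
  using assms(2) by (intro eq_matI) (auto simp: perm_mat_def)

lemma e_elem_eq: "e_elem n k = proj_class (sign_mat n {..<k})"
  by (simp only: e_elem_def sign_mat_def lessThan_iff)

theorem theorem4p12:
  fixes n :: nat and D :: "'a::field mat set set"
  assumes "alg_closed_field TYPE('a)"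
    and "(2::'a) \<noteq> 0"
    and "n \<ge> 2" and "even n"
    and "elem_abelian_2_subgroup (PGL n) D"
    and "D \<noteq> {\<one>\<^bsub>PGL n\<^esub>}"
    and "PGL_toral n D"
    and "PGL_centralizer n D = PGL_identity_component n (PGL_centralizer n D)"
  shows "\<exists>x\<in>D. x \<noteq> \<one>\<^bsub>PGL n\<^esub> \<and> \<not> conjugate_in (PGL n) x (e_elem n (n div 2))"
proof (rule ccontr)
  assume "\<not> ?thesis"
  then have conj: "conjugate_in (PGL n) x (proj_class (sign_mat n {..<n div 2}))"
    if "x \<in> D" "x \<noteq> \<one>\<^bsub>PGL n\<^esub>" for x
    using that by (auto simp: e_elem_eq)
  note char = assms(2)
  have n: "n > 0" using assms(3) by simp
  have D: "subgroup D (PGL n)" using assms(5) by (simp add: elem_abelian_2_subgroup_def)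
  note one_D = subgroup.one_closed[OF D] and sub_D = subgroup.subset[OF D]
  obtain T where T: "PGL_torus n T" "D \<subseteq> T"
    using assms(7) by (auto simp: PGL_toral_def PGL_maximal_torus_def)
  then have T_sub: "subgroup T (PGL n)" and T_conn: "PGL_connected n T"
    and T_comm: "\<And>x y. x \<in> T \<Longrightarrow> y \<in> T \<Longrightarrow> x \<otimes>\<^bsub>PGL n\<^esub> y = y \<otimes>\<^bsub>PGL n\<^esub> x"
    by (auto simp: PGL_torus_def)

  \<comment> \<open>Involutory lifts of D and their diagonal form\<close>
  define L where "L = {A \<in> GL_set n. A * A = 1\<^sub>m n \<and> proj_class A \<in> D}"
  have L: "A \<in> GL_set n" "A \<in> carrier_mat n n" "A * A = 1\<^sub>m n" "proj_class A \<in> D" if "A \<in> L" for A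
    using that by (auto simp: L_def GL_set_carrier)
  \<comment> \<open>The connected set is the torus \<open>T\<close>: all its elements commute with
    the class of \<open>B\<close>, and it contains the class of \<open>A\<close>.\<close>
  have comm: "A * B = B * A" if "A \<in> L" "B \<in> L" for A B
    by (rule PGL_connected_commuting_lifts[OF char n T_conn subgroup.subset[OF T_sub]
          subgroup.one_closed[OF T_sub] L(1)[OF that(2)] L(3)[OF that(2)] _ L(1)[OF that(1)]])
      (use T T_comm L(4) that in auto)
  have lift: "\<exists>A\<in>L. proj_class A = x" if x: "x \<in> D" for x
  proof (cases "x = \<one>\<^bsub>PGL n\<^esub>")
    case True
    then show ?thesis using one_D by (intro bexI[of _ "1\<^sub>m n"]) (auto simp: L_def PGL_one GL_set_one)
  next
    case False
    obtain X where X: "X \<in> GL_set n" "x = proj_class X" using x sub_D by (auto simp: PGL_carrier)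
    define E where "E = (sign_mat n {..<n div 2} :: 'a mat)"
    have E: "E \<in> GL_set n" "E * E = 1\<^sub>m n" by (simp_all add: E_def sign_mat_GL sign_mat_square)
    obtain G c where G: "G \<in> GL_set n" "c \<noteq> 0" "G * X = c \<cdot>\<^sub>m (E * G)"
      using conjugate_in_PGL_imp[OF X(1) E(1)] conj[OF x False] X(2) unfolding E_def by blast
    obtain R where R: "R \<in> GL_set n" "G * R = 1\<^sub>m n" "R * G = 1\<^sub>m n" using GL_set_inverse[OF G(1)] by metis
    note c = GL_set_carrier[OF X(1)] GL_set_carrier[OF E(1)] GL_set_carrier[OF G(1)] GL_set_carrier[OF R(1)]
    note assoc = assoc_mult_mat[of _ n n _ n _ n]
    \<comment> \<open>With \<open>R\<close> the inverse of \<open>G\<close>, this conjugate of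
      \<open>E\<close> is involutory and agrees with \<open>X\<close> up to the scalar
      \<open>c\<close>.\<close>
    let ?A = "R * (E * G)"
    have "?A * ?A = R * (E * ((G * R) * (E * G)))" using c by (simp add: assoc)
    also have "\<dots> = R * ((E * E) * G)" using c R by (simp add: assoc)
    also have "\<dots> = 1\<^sub>m n" using c R E by simp
    finally have "?A * ?A = 1\<^sub>m n" .
    moreover have "X = c \<cdot>\<^sub>m ?A"
    proof -
      have "X = (R * G) * X" using c R by simp
      also have "\<dots> = R * (c \<cdot>\<^sub>m (E * G))" using c G by (simp add: assoc)
      also have "\<dots> = c \<cdot>\<^sub>m ?A" using c by (simp add: mult_smult_distrib[of _ n n _ n])
      finally show ?thesis .
    qed
    then have "proj_class ?A = x" using X G by (simp add: proj_class_smult)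
    moreover have "?A \<in> GL_set n" using R E G by (intro GL_set_mult)
    ultimately show ?thesis using x by (intro bexI[of _ ?A]) (auto simp: L_def)
  qed

  have "finite L" using comm L by (intro finite_commuting_involutions[OF char, of _ n]) auto
  then obtain P s where P: "P \<in> GL_set n"
    and s: "\<And>A. A \<in> L \<Longrightarrow> s A \<subseteq> {..<n} \<and> A * P = P * sign_mat n (s A)"
    by (rule simultaneous_sign_diagonalization[OF char, of L n]) (use comm L in auto)
  obtain R where R: "R \<in> GL_set n" "P * R = 1\<^sub>m n" "R * P = 1\<^sub>m n" using GL_set_inverse[OF P] by metis
  note c = GL_set_carrier[OF P] GL_set_carrier[OF R(1)]
  note assoc = assoc_mult_mat[of _ n n _ n _ n]
  have RAP: "R * A * P = sign_mat n (s A)" if A: "A \<in> L" for A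
  proof -
    have "R * A * P = R * (P * sign_mat n (s A))" using s[OF A] c L(2)[OF A] by (simp add: assoc)
    also have "\<dots> = (R * P) * sign_mat n (s A)" using c by (simp add: assoc)
    also have "\<dots> = sign_mat n (s A)" using R by simp
    finally show ?thesis .
  qed
  have diag: "A = P * sign_mat n (s A) * R" if A: "A \<in> L" for A
  proof -
    have "A = A * (P * R)" using R L(2)[OF A] by simp
    also have "\<dots> = A * P * R" using c L(2)[OF A] by (simp add: assoc)
    also have "A * P = P * sign_mat n (s A)" using s[OF A] by simp
    finally show ?thesis .
  qed
  have s_eqI: "s A = S" if "A \<in> L" "S \<subseteq> {..<n}" "R * A * P = sign_mat n S" for A S
    using sign_mat_inj[OF char] that RAP s by metis
  have conj_scalar: "R * (d \<cdot>\<^sub>m 1\<^sub>m n) * P = d \<cdot>\<^sub>m 1\<^sub>m n" for d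
    using c R by (simp add: mult_smult_distrib[of _ n n _ n] mult_smult_assoc_mat[of _ n n _ n])
  have minus_one: "(-1) \<cdot>\<^sub>m 1\<^sub>m n = (sign_mat n {..<n} :: 'a mat)"
    using uminus_sign_mat[of n "{}"] by (simp add: sign_mat_empty)
  \<comment> \<open>The identity class has -1 as a second involutory lift; it will supply the
    all-one word.\<close>
  have minus_one_L: "(-1) \<cdot>\<^sub>m 1\<^sub>m n \<in> L"
    unfolding L_def using one_D
    by (simp add: proj_class_smult GL_set_smult GL_set_one PGL_one)
      (simp add: minus_one sign_mat_square)
  have scalar: "s A = {} \<or> s A = {..<n}" if A: "A \<in> L" "proj_class A = \<one>\<^bsub>PGL n\<^esub>" for A
  proof -
    obtain d where d: "d \<noteq> 0" "A = d \<cdot>\<^sub>m 1\<^sub>m n" using A(2) by (auto simp: PGL_one proj_class_eq_iff)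
    have "(d * d) \<cdot>\<^sub>m 1\<^sub>m n = 1 \<cdot>\<^sub>m (1\<^sub>m n :: 'a mat)"
      using L(3)[OF A(1)] unfolding d
      by (simp add: mult_smult_distrib[of _ n n _ n] smult_smult_mat)
    then have "d * d = 1" using smult_mat_cancel[OF _ GL_set_one n] by blast
    then have "d = 1 \<or> d = -1" by (simp add: square_eq_1_iff)
    then have "R * A * P = sign_mat n {} \<or> R * A * P = sign_mat n {..<n}"
      using conj_scalar[of d] minus_one unfolding d by (auto simp: sign_mat_empty)
    then show ?thesis using s_eqI[OF A(1)] by auto
  qed

  \<comment> \<open>The binary code of the lifts\<close>
  define F where "F = s ` L"
  have F_sub: "F \<subseteq> Pow {..<n}" using s by (auto simp: F_def)
  have F_full: "{..<n} \<in> F"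
  proof -
    have "s ((-1) \<cdot>\<^sub>m 1\<^sub>m n) = {..<n}"
      using conj_scalar[of "-1"] by (intro s_eqI[OF minus_one_L]) (simp_all only: minus_one subset_refl)
    then show ?thesis using minus_one_L unfolding F_def by (metis imageI)
  qed
  have F_sym: "sym_diff S T \<in> F" if ST: "S \<in> F" "T \<in> F" for S T
  proof -
    obtain A B where AB: "A \<in> L" "B \<in> L" "S = s A" "T = s B" using ST by (auto simp: F_def)
    note cAB = L(2)[OF AB(1)] L(2)[OF AB(2)]
    \<comment> \<open>Lifts in \<open>L\<close> commute, so their product squares to the identity
      and lies in \<open>L\<close> again.\<close>
    have "(A * B) * (A * B) = A * (B * A) * B" using cAB by (simp add: assoc)
    also have "\<dots> = (A * A) * (B * B)" unfolding comm[OF AB(2,1)] using cAB by (simp add: assoc)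
    also have "\<dots> = 1\<^sub>m n" using L(3) AB by simp
    finally have "(A * B) * (A * B) = 1\<^sub>m n" .
    moreover have "proj_class (A * B) \<in> D"
      using subgroup.m_closed[OF D L(4)[OF AB(1)] L(4)[OF AB(2)]] unfolding PGL_mult[OF cAB] .
    ultimately have AB_L: "A * B \<in> L"
      using GL_set_mult[OF L(1)[OF AB(1)] L(1)[OF AB(2)]] unfolding L_def by blast
    have "R * (A * B) * P = R * (A * ((P * R) * (B * P)))" using c cAB R by (simp add: assoc)
    also have "\<dots> = (R * A * P) * (R * B * P)" using c cAB by (simp add: assoc)
    also have "\<dots> = sign_mat n (sym_diff (s A) (s B))" using RAP AB by (simp add: sign_mat_mult)
    finally have "s (A * B) = sym_diff (s A) (s B)" using s AB by (intro s_eqI[OF AB_L]) auto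
    then show ?thesis using AB AB_L unfolding F_def by (metis imageI)
  qed
  have F_weight: "2 * card S = n" if S: "S \<in> F" "S \<noteq> {}" "S \<noteq> {..<n}" for S
  proof -
    obtain A where A: "A \<in> L" "S = s A" using S by (auto simp: F_def)
    \<comment> \<open>By \<open>scalar\<close>, a word other than the zero and the all-one word
      comes from a nontrivial class, to which the assumed conjugacy applies. Then
      \<open>G * P\<close> relates its sign matrix to the balanced one.\<close>
    have "proj_class A \<noteq> \<one>\<^bsub>PGL n\<^esub>" using scalar[OF A(1)] A that by auto
    then obtain G d where G: "G \<in> GL_set n" "G * A = d \<cdot>\<^sub>m (sign_mat n {..<n div 2} * G)"
      using conjugate_in_PGL_imp[OF L(1)[OF A(1)] sign_mat_GL] conj[OF L(4)[OF A(1)]] by metis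
    note cG = GL_set_carrier[OF G(1)]
    have "(G * P) * sign_mat n S = G * (A * P)" using s[OF A(1)] A c cG by (simp add: assoc)
    also have "\<dots> = (G * A) * P" using cG c L(2)[OF A(1)] by (simp add: assoc)
    also have "\<dots> = d \<cdot>\<^sub>m (sign_mat n {..<n div 2} * (G * P))"
      unfolding G mult_smult_assoc_mat[OF mult_carrier_mat[OF sign_mat_carrier cG] c(1)]
      using cG c by (simp add: assoc)
    finally show ?thesis
      using s[OF A(1)] A G P assms(4) n
      by (intro projectively_similar_balanced_sign_mat_card[OF char GL_set_mult[of G n P]]) auto
  qed

  \<comment> \<open>A centralizing class that anticommutes with a lift\<close>
  obtain x where "x \<in> D" "x \<noteq> \<one>\<^bsub>PGL n\<^esub>" using assms(6) one_D by auto
  then obtain A0 where A0: "A0 \<in> L" "proj_class A0 \<noteq> \<one>\<^bsub>PGL n\<^esub>" using lift by metis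
  \<comment> \<open>The zero or all-one word would make \<open>A0\<close> plus or minus the
    identity. Hence there are positions \<open>a\<close> inside and \<open>b\<close> outside, whose
    quotient character is -1 at \<open>s A0\<close>.\<close>
  have "s A0 \<noteq> {}"
  proof
    assume "s A0 = {}"
    then have "A0 = 1\<^sub>m n" using diag[OF A0(1)] c R by (simp add: sign_mat_empty)
    then show False using A0 by (simp add: PGL_one)
  qed
  then obtain a where a: "a \<in> s A0" by auto
  have "s A0 \<noteq> {..<n}"
  proof
    assume "s A0 = {..<n}"
    then have "A0 = P * ((-1) \<cdot>\<^sub>m 1\<^sub>m n) * R" using diag[OF A0(1)] minus_one by simp
    also have "\<dots> = (-1) \<cdot>\<^sub>m 1\<^sub>m n"
      using c R by (simp add: mult_smult_distrib[of _ n n _ n] mult_smult_assoc_mat[of _ n n _ n])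
    finally show False using A0 by (simp add: PGL_one proj_class_smult)
  qed
  then obtain b where b: "b < n" "b \<notin> s A0" using s[OF A0(1)] by auto
  have a_less: "a < n" using a s[OF A0(1)] by auto
  obtain p where p: "p permutes {..<n}"
    and pS: "\<And>i S. i < n \<Longrightarrow> S \<in> F \<Longrightarrow> p i \<in> S \<longleftrightarrow> (i \<in> S) \<noteq> ((a \<in> S) \<noteq> (b \<in> S))"
    by (rule code_translation_permutation[OF F_sub F_full a_less b(1)]) (use F_sym F_weight in blast)+

  define M where "M = (perm_mat n p :: 'a mat)"
  \<comment> \<open>The permutation acts in the diagonalizing basis; \<open>P\<close> carries it
    back to the original one.\<close>
  define g where "g = P * M * R"
  have M: "M \<in> GL_set n" unfolding M_def by (rule perm_mat_GL[OF p])
  note cM = GL_set_carrier[OF M]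
  have g: "g \<in> GL_set n" unfolding g_def using P R M by (intro GL_set_mult)
  \<comment> \<open>The commutator sign of \<open>g\<close> with each lift is the quotient of the
    coordinates \<open>a\<close> and \<open>b\<close>. Being a scalar, it disappears in
    \<open>PGL n\<close>, so the class of \<open>g\<close> centralizes \<open>D\<close>.\<close>
  have gA: "g * A = (if (a \<in> s A) \<noteq> (b \<in> s A) then -1 else 1) \<cdot>\<^sub>m (A * g)" if A: "A \<in> L" for A
  proof -
    define e where "e = (if (a \<in> s A) \<noteq> (b \<in> s A) then -1 else 1 :: 'a)"
    define Q where "Q = (sign_mat n (s A) :: 'a mat)"
    have cQ: "Q \<in> carrier_mat n n" by (simp add: Q_def)
    have MQ: "M * Q = e \<cdot>\<^sub>m (Q * M)"
      unfolding M_def Q_def e_def using pS A by (intro perm_mat_mult_sign_mat[OF p]) (auto simp: F_def)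
    have AQ: "A = P * Q * R" using diag[OF A] by (simp add: Q_def)
    have conj_mult: "(P * X * R) * (P * Y * R) = P * (X * Y) * R"
      if "X \<in> carrier_mat n n" "Y \<in> carrier_mat n n" for X Y
    proof -
      have "(P * X * R) * (P * Y * R) = P * (X * ((R * P) * (Y * R)))" using c that by (simp add: assoc)
      then show ?thesis using c R that by (simp add: assoc)
    qed
    have "g * A = P * (M * Q) * R" unfolding g_def AQ by (rule conj_mult[OF cM cQ])
    also have "\<dots> = e \<cdot>\<^sub>m (P * (Q * M) * R)"
      unfolding MQ using c cM cQ by (simp add: mult_smult_distrib[of _ n n _ n] mult_smult_assoc_mat[of _ n n _ n])
    also have "P * (Q * M) * R = A * g" unfolding g_def AQ by (rule conj_mult[OF cQ cM, symmetric])
    finally show ?thesis by (simp only: e_def)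
  qed
  have "proj_class g \<in> PGL_centralizer n D"
    unfolding PGL_centralizer_def
  proof (intro CollectI conjI ballI)
    show "proj_class g \<in> carrier (PGL n)" using g by (simp add: PGL_carrier)
    fix d assume "d \<in> D"
    then obtain A where A: "A \<in> L" "d = proj_class A" using lift by metis
    show "proj_class g \<otimes>\<^bsub>PGL n\<^esub> d = d \<otimes>\<^bsub>PGL n\<^esub> proj_class g"
      unfolding A(2) PGL_commute_iff[OF L(1)[OF A(1)] g]
      by (rule exI, rule conjI[OF _ gA[OF A(1)]]) simp
  qed
  then obtain S where S: "S \<subseteq> PGL_centralizer n D" "\<one>\<^bsub>PGL n\<^esub> \<in> S" "PGL_connected n S" "proj_class g \<in> S"
    using assms(8) unfolding PGL_identity_component_def by blast
  \<comment> \<open>The connected set \<open>S\<close> in the centralizer joins the identity to the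
    class of \<open>g\<close>, which forces the sign 1 at \<open>A0\<close>, whereas
    \<open>gA\<close> gives -1.\<close>
  have "g * A0 = A0 * g"
    by (rule PGL_connected_commuting_lifts[OF char n S(3) _ S(2) L(1)[OF A0(1)] L(3)[OF A0(1)] _ g S(4)])
      (use S L(4)[OF A0(1)] in \<open>auto simp: PGL_centralizer_def\<close>)
  then have "1 \<cdot>\<^sub>m (A0 * g) = (-1) \<cdot>\<^sub>m (A0 * g)" using gA[OF A0(1)] a b by simp
  then have "(1::'a) = -1" using smult_mat_cancel[OF _ GL_set_mult[OF L(1)[OF A0(1)] g] n] by blast
  then show False using char by (metis add.right_inverse one_add_one)
qed

end
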